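(* Let $X$ be an infinite-dimensional real Banach space, $\mu$ a convex measure of noncompactness on $X$, $I=[0,a]$ with $a>0$, $G\subseteq L_1(I,X)$ a nonempty bounded subset, and $\psi\in L_1(I,\mathbb R^+)$ such that $\sup_{g\in G}\|g(t)\|\le\psi(t)$ for a.e. $t\in I$. Assume that $\mathbb J_G:I\to C_b(\Omega)$ is strongly measurable. Then, for $0<t\le a$, the inequality $$\mu\Big(\int_0^tG(s)\,ds\Big)\le\int_0^t\mu\big(G(s)\big)\,ds$$ holds if one of the following conditions is satisfied: (i) $0<t\le\min\{1,a\}$; (ii) $\mu$ is a sublinear measure of noncompactness.
   Context: $L_1(I,X)$ is the space of Lebesgue–Bochner integrable $X$-valued functions on $I$; $G(t)=\{g(t):g\in G\}$ and $\int_0^tG(s)ds=\{\int_0^tg(s)ds:g\in G\}$. The integral on the right may be $+\infty$. $\Omega=B_{X^*}$ with the norm topology, $C_b(\Omega)$ is the Banach space of bounded continuous real functions on $\Omega$ with the sup-norm, and $\mathbb J_G$ is defined (for a.e. $t$) by $\mathbb J_G(t)(x^* )=\sup_{g\in G}\langle x^*,g(t)\rangle$, $x^*\in\Omega$. Strongly measurable means being the a.e. norm-limit of a sequence of simple functions. $\mathcal B(X)$ is the set of nonempty bounded subsets of $X$. A convex measure of noncompactness on $X$ is a function $\mu:\mathcal B(X)\to[0,\infty)$ such that for all $A,B\in\mathcal B(X)$: (1) $\mu(B)=0$ iff $B$ is relatively compact; (2) $A\supset B$ implies $\mu(A)\ge\mu(B)$; (3) $\mu({\rm co}(B))=\mu(B)$;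 (4) $\mu(\lambda A+(1-\lambda)B)\le\lambda\mu(A)+(1-\lambda)\mu(B)$ for $0\le\lambda\le1$. A sublinear measure of noncompactness is a function satisfying (1), (2), (3) together with $\mu(A+B)\le\mu(A)+\mu(B)$ and $\mu(kB)=k\mu(B)$ for all $k\ge0$. *)

theory Defs
  imports "HOL-Analysis.Analysis"
begin

section \<open>Strong measurability and the Bochner integral\<close>

text \<open>
  The library's \<^const>\<open>has_bochner_integral\<close> is confined to second countable (separable) spaces
  and uses Borel measurability. Neither \<open>X\<close> nor the space of bounded continuous functions on
  the dual ball need be separable, so Borel measurability is replaced here by strong
  measurability; otherwise the definition is that of the library. These notions
  are meant for complete measures such as \<open>lebesgue_on S\<close>, where an almost everywhere limit
  of simple functions is Borel measurable.
\<close>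

definition strongly_measurable :: "'s measure \<Rightarrow> ('s \<Rightarrow> 'b::topological_space) \<Rightarrow> bool" where
  "strongly_measurable M f \<longleftrightarrow>
    (\<exists>s. (\<forall>n. simple_function M (s n)) \<and> (AE x in M. (\<lambda>n. s n x) \<longlonglongrightarrow> f x))"

definition has_bochner :: "'s measure \<Rightarrow> ('s \<Rightarrow> 'b::real_normed_vector) \<Rightarrow> 'b \<Rightarrow> bool" where
  "has_bochner M f v \<longleftrightarrow>
    strongly_measurable M f \<and>
    (\<exists>s. (\<forall>n. Bochner_Integration.simple_bochner_integrable M (s n)) \<and>
         (\<lambda>n. \<integral>\<^sup>+ x. ennreal (norm (f x - s n x)) \<partial>M) \<longlonglongrightarrow> 0 \<and>
         (\<lambda>n. Bochner_Integration.simple_bochner_integral M (s n)) \<longlonglongrightarrow> v)"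

definition bochner_integrable :: "'s measure \<Rightarrow> ('s \<Rightarrow> 'b::real_normed_vector) \<Rightarrow> bool" where
  "bochner_integrable M f \<longleftrightarrow> (\<exists>v. has_bochner M f v)"

definition bochner_integral :: "'s measure \<Rightarrow> ('s \<Rightarrow> 'b::real_normed_vector) \<Rightarrow> 'b" where
  "bochner_integral M f = (THE v. has_bochner M f v)"

text \<open>Elements of \<open>L\<^sub>1\<close> are represented by functions, not by classes modulo null sets.\<close>

definition L1 :: "'s measure \<Rightarrow> ('s \<Rightarrow> 'b::real_normed_vector) set" where
  "L1 M = {f. bochner_integrable M f}"

definition L1_bounded :: "'s measure \<Rightarrow> ('s \<Rightarrow> 'b::real_normed_vector) set \<Rightarrow> bool" where
  "L1_bounded M G \<longleftrightarrow> (\<exists>C::real. \<forall>g\<in>G. (\<integral>\<^sup>+ x. ennreal (norm (g x)) \<partial>M) \<le> ennreal C)"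


section \<open>The closed unit ball of the dual space, with the norm topology\<close>

typedef (overloaded) ('a::real_normed_vector) dual_ball = "cball (0 :: 'a \<Rightarrow>\<^sub>L real) 1"
  by (rule exI[of _ 0]) simp

instantiation dual_ball :: (real_normed_vector) metric_space
begin

definition dist_dual_ball :: "'a dual_ball \<Rightarrow> 'a dual_ball \<Rightarrow> real" where
  "dist_dual_ball x y = dist (Rep_dual_ball x) (Rep_dual_ball y)"

definition uniformity_dual_ball :: "('a dual_ball \<times> 'a dual_ball) filter" where
  "uniformity_dual_ball = (INF e\<in>{0 <..}. principal {(x, y). dist x y < e})"

definition open_dual_ball :: "'a dual_ball set \<Rightarrow> bool" where
  "open_dual_ball S = (\<forall>x\<in>S. \<forall>\<^sub>F (x', y) in uniformity. x' = x \<longrightarrow> y \<in> S)"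

instance
proof
  fix x y z :: "'a dual_ball"
  show "dist x y = 0 \<longleftrightarrow> x = y"
    by (simp add: dist_dual_ball_def Rep_dual_ball_inject)
  show "dist x y \<le> dist x z + dist y z"
    unfolding dist_dual_ball_def by (rule dist_triangle2)
qed (simp_all add: uniformity_dual_ball_def open_dual_ball_def)

end

definition eval_at :: "'a::real_normed_vector \<Rightarrow> 'a dual_ball \<Rightarrow> real" where
  "eval_at x \<xi> = blinfun_apply (Rep_dual_ball \<xi>) x"

text \<open>
  The values of \<open>J_map G\<close> are elements of the Banach space of bounded continuous functions
  on the dual ball. Where \<open>{g t | g. g \<in> G}\<close> is unbounded, the supremum need not define such a
  function and the value is unspecified; if \<open>G\<close> is dominated by an integrable function this
  happens only on a null set.
\<close>

definition J_map :: "(real \<Rightarrow> 'a::real_normed_vector) set \<Rightarrow> real \<Rightarrow> ('a dual_ball \<Rightarrow>\<^sub>C real)" where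
  "J_map G t = Bcontfun (\<lambda>\<xi>. SUP g\<in>G. eval_at (g t) \<xi>)"

lemma eval_at_le: "\<bar>eval_at x \<xi>\<bar> \<le> norm x"
proof -
  have "\<bar>eval_at x \<xi>\<bar> \<le> norm (Rep_dual_ball \<xi>) * norm x"
    unfolding eval_at_def using norm_blinfun[of "Rep_dual_ball \<xi>" x] by simp
  also have "\<dots> \<le> 1 * norm x"
    using Rep_dual_ball[of \<xi>] by (intro mult_right_mono) auto
  finally show ?thesis by simp
qed

lemma eval_at_diff: "eval_at x \<xi> \<le> eval_at x \<eta> + dist \<xi> \<eta> * norm x"
proof -
  have "eval_at x \<xi> - eval_at x \<eta> = blinfun_apply (Rep_dual_ball \<xi> - Rep_dual_ball \<eta>) x"
    by (simp add: eval_at_def blinfun.diff_left)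
  also have "\<dots> \<le> norm (Rep_dual_ball \<xi> - Rep_dual_ball \<eta>) * norm x"
    using norm_blinfun[of "Rep_dual_ball \<xi> - Rep_dual_ball \<eta>" x] by simp
  finally show ?thesis by (simp add: dist_dual_ball_def dist_norm)
qed

lemma apply_J_map:
  assumes "G \<noteq> {}" and bd: "bounded ((\<lambda>g. g t) ` G)"
  shows "apply_bcontfun (J_map G t) \<xi> = (SUP g\<in>G. eval_at (g t) \<xi>)"
proof -
  let ?f = "\<lambda>\<xi>. SUP g\<in>G. eval_at (g t) \<xi>"
  obtain K where K: "\<And>g. g \<in> G \<Longrightarrow> norm (g t) \<le> K"
    using bd by (auto simp: bounded_iff)
  obtain g0 where g0: "g0 \<in> G" using assms(1) by blast
  have K0: "0 \<le> K" using K[OF g0] norm_ge_zero order_trans by blast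
  have le: "eval_at (g t) \<xi> \<le> K" "- K \<le> eval_at (g t) \<xi>" if "g \<in> G" for g \<xi>
    using eval_at_le[of "g t" \<xi>] K[OF that] by linarith+
  have bdd: "bdd_above ((\<lambda>g. eval_at (g t) \<xi>) ` G)" for \<xi>
    using le(1) by (auto intro!: bdd_aboveI2)
  have up: "?f \<xi> \<le> ?f \<eta> + K * dist \<xi> \<eta>" for \<xi> \<eta>
  proof (rule cSUP_least[OF assms(1)])
    fix g assume g: "g \<in> G"
    have "eval_at (g t) \<xi> \<le> eval_at (g t) \<eta> + dist \<xi> \<eta> * norm (g t)" by (rule eval_at_diff)
    also have "\<dots> \<le> ?f \<eta> + dist \<xi> \<eta> * K"
      by (intro add_mono cSUP_upper mult_left_mono bdd g K) auto
    finally show "eval_at (g t) \<xi> \<le> ?f \<eta> + K * dist \<xi> \<eta>" by (simp add: mult.commute)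
  qed
  have lip: "K-lipschitz_on UNIV ?f"
  proof (rule lipschitz_onI[OF _ K0])
    fix \<xi> \<eta> :: "'a dual_ball"
    show "dist (?f \<xi>) (?f \<eta>) \<le> K * dist \<xi> \<eta>"
      using up[of \<xi> \<eta>] up[of \<eta> \<xi>] by (simp add: dist_real_def dist_commute abs_le_iff)
  qed
  have bnd: "bounded (range ?f)"
  proof (rule boundedI)
    fix r assume "r \<in> range ?f"
    then obtain \<xi> where r: "r = ?f \<xi>" by blast
    have "?f \<xi> \<le> K" by (rule cSUP_least[OF assms(1)]) (rule le(1))
    moreover have "- K \<le> ?f \<xi>"
      using le(2)[OF g0, of \<xi>] cSUP_upper[OF g0 bdd[of \<xi>]] by linarith
    ultimately show "norm r \<le> K" by (simp add: r abs_le_iff)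
  qed
  have "?f \<in> bcontfun"
    using lipschitz_on_continuous_on[OF lip] bnd by (simp add: bcontfun_def)
  then show ?thesis
    unfolding J_map_def by (simp add: Bcontfun_inverse)
qed


section \<open>Measures of noncompactness\<close>

definition bounded_sets :: "'a::real_normed_vector set set" where
  "bounded_sets = {B. B \<noteq> {} \<and> bounded B}"

text \<open>
  A measure of noncompactness is a total function on sets, of which only the values on
  \<^const>\<open>bounded_sets\<close> are constrained. \<open>A + B\<close> is the Minkowski sum.
\<close>

definition mnc_axioms :: "('a::real_normed_vector set \<Rightarrow> real) \<Rightarrow> bool" where
  "mnc_axioms \<mu> \<longleftrightarrow>
    (\<forall>B\<in>bounded_sets. 0 \<le> \<mu> B) \<and>
    (\<forall>B\<in>bounded_sets. \<mu> B = 0 \<longleftrightarrow> compact (closure B)) \<and>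
    (\<forall>A\<in>bounded_sets. \<forall>B\<in>bounded_sets. B \<subseteq> A \<longrightarrow> \<mu> B \<le> \<mu> A) \<and>
    (\<forall>B\<in>bounded_sets. \<mu> (convex hull B) = \<mu> B)"

definition convex_mnc :: "('a::real_normed_vector set \<Rightarrow> real) \<Rightarrow> bool" where
  "convex_mnc \<mu> \<longleftrightarrow> mnc_axioms \<mu> \<and>
    (\<forall>A\<in>bounded_sets. \<forall>B\<in>bounded_sets. \<forall>l\<in>{0..1::real}.
       \<mu> ((*\<^sub>R) l ` A + (*\<^sub>R) (1 - l) ` B) \<le> l * \<mu> A + (1 - l) * \<mu> B)"

definition sublinear_mnc :: "('a::real_normed_vector set \<Rightarrow> real) \<Rightarrow> bool" where
  "sublinear_mnc \<mu> \<longleftrightarrow> mnc_axioms \<mu> \<and>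
    (\<forall>A\<in>bounded_sets. \<forall>B\<in>bounded_sets. \<mu> (A + B) \<le> \<mu> A + \<mu> B) \<and>
    (\<forall>B\<in>bounded_sets. \<forall>k\<ge>0::real. \<mu> ((*\<^sub>R) k ` B) = k * \<mu> B)"

end

theory Submission
  imports Defs
begin

text \<open>
  The support function determines a set up to its closed convex hull, so the hypothesis on
  \<^const>\<open>J_map\<close> gives, up to a set on which \<open>\<psi>\<close> has a small integral, finitely many pieces on which
  \<open>G s\<close> hardly varies in the Hausdorff distance of the closed convex hulls. By the separation
  theorem the mean value of \<open>G\<close> over the whole interval is then close to a convex combination of
  the hulls of values \<open>G s\<^sub>k\<close>. Convex measures of noncompactness satisfy Jensen's inequality for
  such combinations and are Lipschitz continuous on bounded families of sets. Each \<open>s\<^sub>k\<close> is chosen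
  almost minimal for \<open>\<mu> (G s)\<close> on its piece, so that the resulting sum is almost a lower sum of the
  integral on the right, whose integrand need not be known to be measurable. Passing from the
  mean value to the integral costs a factor \<open>t\<close>: this uses \<open>t \<le> 1\<close> or sublinearity.
\<close>

section \<open>Separation in normed spaces\<close>

definition sublinear_functional :: "('a::real_vector \<Rightarrow> real) \<Rightarrow> bool" where
  "sublinear_functional p \<longleftrightarrow>
    (\<forall>x y. p (x + y) \<le> p x + p y) \<and> (\<forall>x. \<forall>c\<ge>0. p (c *\<^sub>R x) = c * p x)"

text \<open>One inequality for positive factors suffices: applied to \<open>inverse c\<close> and
  \<open>c *\<^sub>R x\<close> it yields the reverse one.\<close>

lemma sublinear_functionalI:
  fixes p :: "'a::real_vector \<Rightarrow> real"
  assumes add: "\<And>x y. p (x + y) \<le> p x + p y"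
    and scale: "\<And>c x. 0 < c \<Longrightarrow> p (c *\<^sub>R x) \<le> c * p x"
    and zero: "p 0 = 0"
  shows "sublinear_functional p"
proof -
  have "p (c *\<^sub>R x) = c * p x" if "0 \<le> c" for c x
  proof (cases "c = 0")
    case False
    then have c: "0 < c" using that by simp
    have "p x \<le> inverse c * p (c *\<^sub>R x)"
      using scale[of "inverse c" "c *\<^sub>R x"] c by simp
    then have "c * p x \<le> p (c *\<^sub>R x)"
      using c by (simp add: field_simps)
    then show ?thesis using scale[OF c, of x] by simp
  qed (simp add: zero)
  then show ?thesis using add by (simp add: sublinear_functional_def)
qed

lemma sublinear_functional_add: "sublinear_functional p \<Longrightarrow> p (x + y) \<le> p x + p y"
  and sublinear_functional_scale: "sublinear_functional p \<Longrightarrow> 0 \<le> c \<Longrightarrow> p (c *\<^sub>R x) = c * p x"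
  by (auto simp: sublinear_functional_def)

lemma sublinear_functional_zero: "sublinear_functional p \<Longrightarrow> p 0 = 0"
  using sublinear_functional_scale[of p 0 0] by simp

lemma sublinear_functional_uminus: "sublinear_functional p \<Longrightarrow> - p (- x) \<le> p x"
  using sublinear_functional_add[of p x "- x"] sublinear_functional_zero[of p] by simp

text \<open>The infimum of \<open>q (x + l *\<^sub>R c) - l * d\<close> over
  \<open>l \<ge> 0\<close> and \<open>c \<in> D\<close> is the largest sublinear functional below
  \<open>q\<close> that satisfies the last condition. A singleton \<open>D\<close> serves to show
  that minimal sublinear functionals are linear, a general convex \<open>D\<close> to separate a
  point from a convex set.\<close>

lemma sublinear_functional_lower:
  fixes q :: "'a::real_vector \<Rightarrow> real"
  assumes q: "sublinear_functional q" and D: "convex D" "D \<noteq> {}" and d: "\<And>c. c \<in> D \<Longrightarrow> d \<le> q c"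
  obtains r where "sublinear_functional r" "\<And>x. r x \<le> q x" "\<And>c. c \<in> D \<Longrightarrow> r (- c) \<le> - d"
proof
  define \<phi> where "\<phi> = (\<lambda>x (l, c). q (x + l *\<^sub>R c) - l * d)"
  define A where "A = {0::real..} \<times> D"
  define r where "r = (\<lambda>x. INF z\<in>A. \<phi> x z)"
  have A: "A \<noteq> {}" using D by (auto simp: A_def)
  \<comment> \<open>This bound keeps the infimum finite; it is where \<open>d \<le> q c\<close> on
    \<open>D\<close> enters.\<close>
  have lb: "- q (- x) \<le> \<phi> x z" if "z \<in> A" for x z
  proof -
    obtain l c where z: "z = (l, c)" "0 \<le> l" "c \<in> D" using \<open>z \<in> A\<close> by (auto simp: A_def)
    have "q (l *\<^sub>R c) \<le> q (x + l *\<^sub>R c) + q (- x)"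
      using sublinear_functional_add[OF q, of "x + l *\<^sub>R c" "- x"] by simp
    moreover have "l * d \<le> q (l *\<^sub>R c)"
      using d[OF z(3)] z(2) by (simp add: sublinear_functional_scale[OF q] mult_left_mono)
    ultimately show ?thesis by (simp add: \<phi>_def z(1))
  qed
  have bdd: "bdd_below (\<phi> x ` A)" for x
    using lb by (auto intro!: bdd_belowI2)
  have le: "r x \<le> \<phi> x z" if "z \<in> A" for x z
    unfolding r_def by (rule cINF_lower[OF bdd that])
  have ge: "m \<le> r x" if "\<And>z. z \<in> A \<Longrightarrow> m \<le> \<phi> x z" for m x
    unfolding r_def by (rule cINF_greatest[OF A that])
  show rq: "r x \<le> q x" for x
    using le[of "(0, SOME c. c \<in> D)" x] D(2) by (auto simp: A_def \<phi>_def some_in_eq)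
  show "r (- c) \<le> - d" if "c \<in> D" for c
    using le[of "(1, c)" "- c"] that by (simp add: A_def \<phi>_def sublinear_functional_zero[OF q])
  have add: "r (x + y) \<le> \<phi> x z + \<phi> y w" if "z \<in> A" "w \<in> A" for x y z w
  proof -
    obtain l c where z: "z = (l, c)" "0 \<le> l" "c \<in> D" using \<open>z \<in> A\<close> by (auto simp: A_def)
    obtain k b where w: "w = (k, b)" "0 \<le> k" "b \<in> D" using \<open>w \<in> A\<close> by (auto simp: A_def)
    \<comment> \<open>Convexity of \<open>D\<close> merges two admissible parameters into one: the
      normalized combination of \<open>c\<close> and \<open>b\<close> lies in \<open>D\<close>. If
      both coefficients vanish, any element of \<open>D\<close> will do.\<close>
    obtain e where e: "e \<in> D" "l *\<^sub>R c + k *\<^sub>R b = (l + k) *\<^sub>R e"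
    proof (cases "l + k = 0")
      case True
      then have "l = 0" "k = 0" using z w by auto
      then show ?thesis using that[of c] z by simp
    next
      case False
      then have pos: "0 < l + k" using z w by linarith
      let ?e = "(l / (l + k)) *\<^sub>R c + (k / (l + k)) *\<^sub>R b"
      have "?e \<in> D"
        using z w pos by (intro convexD[OF D(1)]) (auto simp: add_divide_distrib[symmetric])
      moreover have "l *\<^sub>R c + k *\<^sub>R b = (l + k) *\<^sub>R ?e"
        using False by (simp add: scaleR_add_right)
      ultimately show ?thesis by (rule that)
    qed
    have eq: "(x + l *\<^sub>R c) + (y + k *\<^sub>R b) = x + y + (l + k) *\<^sub>R e"
      unfolding e(2)[symmetric] by (simp add: add_ac)
    have "r (x + y) \<le> \<phi> (x + y) (l + k, e)"
      using z w e by (intro le) (auto simp: A_def)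
    also have "\<dots> = q ((x + l *\<^sub>R c) + (y + k *\<^sub>R b)) - (l + k) * d"
      unfolding eq by (simp add: \<phi>_def)
    also have "\<dots> \<le> \<phi> x z + \<phi> y w"
      using sublinear_functional_add[OF q, of "x + l *\<^sub>R c" "y + k *\<^sub>R b"]
      by (simp add: \<phi>_def z w algebra_simps)
    finally show ?thesis .
  qed
  show "sublinear_functional r"
  proof (rule sublinear_functionalI)
    fix x y
    have step: "r (x + y) - \<phi> x z \<le> r y" if "z \<in> A" for z
      by (rule ge) (use add[OF that, of _ x y] in \<open>simp add: algebra_simps\<close>)
    have "r (x + y) - r y \<le> r x"
      by (rule ge) (use step in \<open>simp add: algebra_simps\<close>)
    then show "r (x + y) \<le> r x + r y" by simp
  next
    fix k :: real and x assume k: "0 < k"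
    have "inverse k * r (k *\<^sub>R x) \<le> \<phi> x z" if "z \<in> A" for z
    proof -
      obtain l c where z: "z = (l, c)" "0 \<le> l" "c \<in> D" using \<open>z \<in> A\<close> by (auto simp: A_def)
      have "r (k *\<^sub>R x) \<le> \<phi> (k *\<^sub>R x) (k * l, c)"
        using z k by (intro le) (auto simp: A_def)
      also have "\<dots> = q (k *\<^sub>R (x + l *\<^sub>R c)) - k * l * d"
        by (simp add: \<phi>_def scaleR_add_right)
      also have "\<dots> = k * \<phi> x z"
        using k by (subst sublinear_functional_scale[OF q]) (auto simp: \<phi>_def z algebra_simps)
      finally show ?thesis using k by (simp add: field_simps)
    qed
    then have "inverse k * r (k *\<^sub>R x) \<le> r x" by (rule ge)
    then show "r (k *\<^sub>R x) \<le> k * r x" using k by (simp add: field_simps)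
  next
    have "0 \<le> r 0"
      using ge[of 0 0] lb[of _ 0] sublinear_functional_zero[OF q] by simp
    then show "r 0 = 0" using rq[of 0] sublinear_functional_zero[OF q] by simp
  qed
qed

text \<open>Zorn's lemma provides a minimal sublinear functional \<open>m\<close> below
  \<open>p\<close>. Lowering it in any direction cannot change it, which makes it superadditive as
  well as subadditive, hence linear.\<close>

lemma sublinear_functional_dominates_linear:
  fixes p :: "'a::real_vector \<Rightarrow> real"
  assumes p: "sublinear_functional p"
  obtains f where "linear f" "\<And>x. f x \<le> p x"
proof -
  define S where "S = {q. sublinear_functional q \<and> (\<forall>x. q x \<le> p x)}"
  \<comment> \<open>The order is reversed so that a maximal element in the sense of Zorn's lemma is
    a minimal functional.\<close>
  have po: "partial_order_on S (relation_of (\<ge>) S)"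
    by (rule partial_order_on_relation_ofI) auto
  have "\<exists>m\<in>S. \<forall>q\<in>S. m \<ge> q \<longrightarrow> q = m"
  proof (rule predicate_Zorn[OF po])
    fix C assume C: "C \<in> Chains (relation_of (\<ge>) S)"
    show "\<exists>u\<in>S. \<forall>q\<in>C. u \<le> q"
    proof (cases "C = {}")
      case True
      then show ?thesis using p by (auto simp: S_def)
    next
      case False
      have CS: "sublinear_functional q" "q x \<le> p x" if "q \<in> C" for q x
        using C that by (auto simp: Chains_def relation_of_def S_def)
      have chain: "q \<le> q' \<or> q' \<le> q" if "q \<in> C" "q' \<in> C" for q q'
        using C that by (auto simp: Chains_def relation_of_def)
      define u where "u = (\<lambda>x. INF q\<in>C. q x)"
      have bdd: "bdd_below ((\<lambda>q. q x) ` C)" for x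
      proof (rule bdd_belowI2)
        fix q assume "q \<in> C"
        then show "- p (- x) \<le> q x"
          using sublinear_functional_uminus[OF CS(1), of q x] CS(2)[of q "- x"] by simp
      qed
      have le: "u x \<le> q x" if "q \<in> C" for q x
        unfolding u_def by (rule cINF_lower[OF bdd that])
      have ge: "m \<le> u x" if "\<And>q. q \<in> C \<Longrightarrow> m \<le> q x" for m x
        unfolding u_def by (rule cINF_greatest[OF False that])
      have "sublinear_functional u"
      proof (rule sublinear_functionalI)
        fix x y
        \<comment> \<open>Of two members of the chain the smaller one can be used at both
          \<open>x\<close> and \<open>y\<close>, and its own subadditivity gives the bound.\<close>
        have both: "u (x + y) \<le> q x + q' y" if "q \<in> C" "q' \<in> C" for q q'
          using chain[OF that] le[OF that(1), of "x + y"] le[OF that(2), of "x + y"]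
            sublinear_functional_add[OF CS(1)[OF that(1)], of x y]
            sublinear_functional_add[OF CS(1)[OF that(2)], of x y]
          by (force simp: le_fun_def dest: spec[of _ x] spec[of _ y])
        have step: "u (x + y) - q x \<le> u y" if "q \<in> C" for q
          by (rule ge) (use both[OF that] in \<open>simp add: algebra_simps\<close>)
        have "u (x + y) - u y \<le> u x"
          by (rule ge) (use step in \<open>simp add: algebra_simps\<close>)
        then show "u (x + y) \<le> u x + u y" by simp
      next
        fix c :: real and x assume c: "0 < c"
        have "inverse c * u (c *\<^sub>R x) \<le> u x"
        proof (rule ge)
          fix q assume q: "q \<in> C"
          have "u (c *\<^sub>R x) \<le> c * q x"
            using le[OF q, of "c *\<^sub>R x"] sublinear_functional_scale[OF CS(1)[OF q], of c x] c by simp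
          then show "inverse c * u (c *\<^sub>R x) \<le> q x" using c by (simp add: field_simps)
        qed
        then show "u (c *\<^sub>R x) \<le> c * u x" using c by (simp add: field_simps)
      next
        show "u 0 = 0"
          using False by (simp add: u_def sublinear_functional_zero CS(1) cong: INF_cong)
      qed
      moreover have "u x \<le> p x" for x
        using False le CS(2) by (meson ex_in_conv order_trans)
      ultimately show ?thesis using le by (auto simp: S_def le_fun_def)
    qed
  qed
  then obtain m where m: "m \<in> S" and min: "\<And>q. q \<in> S \<Longrightarrow> q \<le> m \<Longrightarrow> q = m" by blast
  then have sub: "sublinear_functional m" and mp: "\<And>x. m x \<le> p x" by (auto simp: S_def)
  have super: "m x + m y \<le> m (x + y)" for x y
  proof -
    \<comment> \<open>The singleton \<open>{y}\<close> with \<open>d = m y\<close> lowers the value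
      at \<open>- y\<close> to at most \<open>- m y\<close>; minimality then identifies
      \<open>r\<close> with \<open>m\<close>.\<close>
    obtain r where r: "sublinear_functional r" "\<And>x. r x \<le> m x" "r (- y) \<le> - m y"
      using sublinear_functional_lower[OF sub, of "{y}" "m y"] by auto
    have "r = m"
      using r mp by (intro min) (auto simp: S_def le_fun_def intro: order_trans)
    then have "m (- y) \<le> - m y" using r by simp
    then show ?thesis
      using sublinear_functional_add[OF sub, of "x + y" "- y"] by simp
  qed
  have add: "m (x + y) = m x + m y" for x y
    using super[of x y] sublinear_functional_add[OF sub, of x y] by simp
  have minus: "m (- x) = - m x" for x
    using add[of x "- x"] sublinear_functional_zero[OF sub] by simp
  have "m (c *\<^sub>R x) = c * m x" for c x
  proof (cases "0 \<le> c")
    case False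
    have "m (c *\<^sub>R x) = - m ((- c) *\<^sub>R x)" by (simp add: minus[symmetric])
    also have "m ((- c) *\<^sub>R x) = (- c) * m x"
      using False by (intro sublinear_functional_scale[OF sub]) simp
    finally show ?thesis by simp
  qed (rule sublinear_functional_scale[OF sub])
  then have "linear m" using add by (intro linearI) auto
  then show ?thesis using mp that by blast
qed

section \<open>Separation by functionals of norm at most one\<close>

text \<open>The norm is at least \<open>d\<close> on the convex set of all \<open>x - b\<close>, so
  it can be lowered to a sublinear \<open>r\<close> with \<open>r (b - x) \<le> - d\<close>. A
  linear functional below \<open>r\<close> is also below the norm, hence in the dual ball, and it
  separates with the full gap \<open>d\<close>.\<close>

lemma dual_ball_separation:
  fixes x :: "'a::real_normed_vector"
  assumes B: "convex B" "B \<noteq> {}" and d: "\<And>b. b \<in> B \<Longrightarrow> d \<le> norm (x - b)"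
  obtains \<xi> :: "'a dual_ball" where "\<And>b. b \<in> B \<Longrightarrow> eval_at b \<xi> + d \<le> eval_at x \<xi>"
proof -
  have n: "sublinear_functional (norm :: 'a \<Rightarrow> real)"
    by (simp add: sublinear_functional_def norm_triangle_ineq)
  have D: "convex ((\<lambda>b. x - b) ` B)" "(\<lambda>b. x - b) ` B \<noteq> {}"
    using B convex_translation[OF convex_negations[OF B(1)], of x] by (auto simp: image_image)
  have "d \<le> norm c" if "c \<in> (\<lambda>b. x - b) ` B" for c using that d by auto
  then obtain r where r: "sublinear_functional r" "\<And>y. r y \<le> norm y"
    "\<And>c. c \<in> (\<lambda>b. x - b) ` B \<Longrightarrow> r (- c) \<le> - d"
    using sublinear_functional_lower[OF n D] by metis
  obtain f where f: "linear f" "\<And>y. f y \<le> r y"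
    using sublinear_functional_dominates_linear[OF r(1)] by blast
  have bound: "norm (f y) \<le> norm y * 1" for y
    using f(2)[of y] f(2)[of "- y"] r(2)[of y] r(2)[of "- y"] linear_neg[OF f(1), of y] by simp
  have bl: "bounded_linear f"
    using linear_add[OF f(1)] linear_scale[OF f(1)] bound by (intro bounded_linear_intro[where K = 1]) auto
  have "norm (Blinfun f) \<le> 1"
    using bound by (intro norm_blinfun_bound) (auto simp: bounded_linear_Blinfun_apply[OF bl])
  then have ev: "eval_at y (Abs_dual_ball (Blinfun f)) = f y" for y
    by (simp add: eval_at_def Abs_dual_ball_inverse bounded_linear_Blinfun_apply[OF bl])
  have "f b + d \<le> f x" if "b \<in> B" for b
    using r(3)[of "x - b"] f(2)[of "b - x"] that linear_diff[OF f(1), of b x] by force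
  then show ?thesis by (intro that[of "Abs_dual_ball (Blinfun f)"]) (simp add: ev)
qed

section \<open>Strong measurability and the Bochner integral\<close>

lemma complete_measure_restrict_space:
  assumes "complete_measure M" and S: "S \<in> sets M"
  shows "complete_measure (restrict_space M S)"
proof
  fix A B assume B: "B \<subseteq> A" "A \<in> null_sets (restrict_space M S)"
  then have A: "A \<subseteq> S" "A \<in> null_sets M"
    using S by (auto simp: null_sets_restrict_space)
  then have "B \<in> sets M"
    using complete_measure.complete[OF assms(1) B(1)] by blast
  then show "B \<in> sets (restrict_space M S)"
    using A B S by (auto simp: sets_restrict_space_iff)
qed

text \<open>The pointwise \<open>lim\<close> is Borel measurable everywhere and agrees with
  \<open>f\<close> almost everywhere; completeness carries the measurability of preimages over to
  \<open>f\<close>.\<close>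

lemma (in complete_measure) borel_measurable_AE_limit:
  fixes s :: "nat \<Rightarrow> 'a \<Rightarrow> real"
  assumes s [measurable]: "\<And>n. s n \<in> borel_measurable M"
    and lim: "AE x in M. (\<lambda>n. s n x) \<longlonglongrightarrow> f x"
  shows "f \<in> borel_measurable M"
proof (rule measurableI)
  let ?g = "\<lambda>x. lim (\<lambda>n. s n x)"
  fix A :: "real set" assume [measurable]: "A \<in> sets borel"
  show "f -` A \<inter> space M \<in> sets M"
  proof (rule in_sets_AE)
    show "AE x in M. x \<in> ?g -` A \<inter> space M \<longleftrightarrow> x \<in> f -` A \<inter> space M"
      using lim by eventually_elim (simp add: limI)
    show "?g -` A \<inter> space M \<in> sets M" by measurable
  qed auto
qed simp

text \<open>The norm is an almost everywhere limit of real simple functions. Its measurability is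
  what allows nonnegative integrals of approximation errors to be added.\<close>

lemma strongly_measurable_norm_diff_simple:
  assumes M: "complete_measure M" and f: "strongly_measurable M f" and h: "simple_function M h"
  shows "(\<lambda>x. norm (f x - h x)) \<in> borel_measurable M"
proof -
  obtain s where s: "\<And>n. simple_function M (s n)" "AE x in M. (\<lambda>n. s n x) \<longlonglongrightarrow> f x"
    using f by (auto simp: strongly_measurable_def)
  show ?thesis
  proof (rule complete_measure.borel_measurable_AE_limit[OF M])
    show "(\<lambda>x. norm (s n x - h x)) \<in> borel_measurable M" for n
      by (intro borel_measurable_simple_function
          simple_function_compose2[OF s(1) h, where h = "\<lambda>y z. norm (y - z)"])
    show "AE x in M. (\<lambda>n. norm (s n x - h x)) \<longlonglongrightarrow> norm (f x - h x)"
      using s(2) by eventually_elim (intro tendsto_intros)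
  qed
qed

lemma strongly_measurable_restrict_space:
  assumes f: "strongly_measurable M f" and S: "S \<in> sets M"
  shows "strongly_measurable (restrict_space M S) f"
proof -
  obtain s where s: "\<And>n. simple_function M (s n)" "AE x in M. (\<lambda>n. s n x) \<longlonglongrightarrow> f x"
    using f by (auto simp: strongly_measurable_def)
  have SM: "S \<inter> space M \<in> sets M" "S \<subseteq> space M" using S sets.sets_into_space by auto
  have "simple_function (restrict_space M S) (s n)" for n
    unfolding simple_function_def
  proof safe
    show "finite (s n ` space (restrict_space M S))"
      using s(1)[of n] by (auto simp: simple_function_def space_restrict_space intro: rev_finite_subset)
  next
    fix x
    have "s n -` {s n x} \<inter> space M \<in> sets M" using s(1) by (rule simple_functionD)
    then have "S \<inter> (s n -` {s n x} \<inter> space M) \<in> sets M" using S by blast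
    moreover have "s n -` {s n x} \<inter> space (restrict_space M S) = S \<inter> (s n -` {s n x} \<inter> space M)"
      by (auto simp: space_restrict_space)
    ultimately show "s n -` {s n x} \<inter> space (restrict_space M S) \<in> sets (restrict_space M S)"
      using SM by (auto simp: sets_restrict_space_iff)
  qed
  moreover have "AE x in restrict_space M S. (\<lambda>n. s n x) \<longlonglongrightarrow> f x"
    using s(2) by (auto simp: AE_restrict_space_iff[OF SM(1)])
  ultimately show ?thesis by (auto simp: strongly_measurable_def)
qed

section \<open>Bochner integrals tested by functionals\<close>

lemma eval_at_zero [simp]: "eval_at 0 \<xi> = 0"
  by (simp add: eval_at_def blinfun.zero_right)

lemma bounded_linear_eval_at: "bounded_linear (\<lambda>x. eval_at x \<xi>)"
  unfolding eval_at_def by (rule blinfun.bounded_linear_right)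

lemma eval_at_scaleR: "eval_at (c *\<^sub>R x) \<xi> = c * eval_at x \<xi>"
  by (simp add: eval_at_def blinfun.scaleR_right)

lemma eval_at_sum: "eval_at (\<Sum>k\<in>K. h k) \<xi> = (\<Sum>k\<in>K. eval_at (h k) \<xi>)"
  by (simp add: eval_at_def blinfun.sum_right)

text \<open>A functional in the dual ball does not increase norms, so it maps approximating simple
  functions to approximating simple functions. This reduces questions about Bochner integrals to
  scalar integrals.\<close>

lemma has_bochner_integral_eval_at:
  assumes M: "complete_measure M" and f: "has_bochner M f v"
  shows "has_bochner_integral M (\<lambda>x. eval_at (f x) \<xi>) (eval_at v \<xi>)"
proof -
  interpret T: bounded_linear "\<lambda>x::'b. eval_at x \<xi>" by (rule bounded_linear_eval_at)
  obtain u where u: "\<And>n. simple_function M (u n)" "AE x in M. (\<lambda>n. u n x) \<longlonglongrightarrow> f x"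
    using f by (auto simp: has_bochner_def strongly_measurable_def)
  obtain s where s: "\<And>n. Bochner_Integration.simple_bochner_integrable M (s n)"
    "(\<lambda>n. \<integral>\<^sup>+ x. ennreal (norm (f x - s n x)) \<partial>M) \<longlonglongrightarrow> 0"
    "(\<lambda>n. Bochner_Integration.simple_bochner_integral M (s n)) \<longlonglongrightarrow> v"
    using f by (auto simp: has_bochner_def)
  show ?thesis
  proof (rule has_bochner_integral.intros)
    show "(\<lambda>x. eval_at (f x) \<xi>) \<in> borel_measurable M"
    proof (rule complete_measure.borel_measurable_AE_limit[OF M])
      show "(\<lambda>x. eval_at (u n x) \<xi>) \<in> borel_measurable M" for n
        by (intro borel_measurable_simple_function simple_function_compose1[OF u(1)])
      show "AE x in M. (\<lambda>n. eval_at (u n x) \<xi>) \<longlonglongrightarrow> eval_at (f x) \<xi>"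
        using u(2) by eventually_elim (rule T.tendsto)
    qed
    \<comment> \<open>The rule for composition with two arguments is used with a map that ignores
      the second one.\<close>
    show "Bochner_Integration.simple_bochner_integrable M (\<lambda>x. eval_at (s n x) \<xi>)" for n
      using simple_bochner_integrable_compose2[OF _ s(1) s(1), where p = "\<lambda>y z. eval_at y \<xi>"] by simp
    show "(\<lambda>n. \<integral>\<^sup>+ x. ennreal (norm (eval_at (f x) \<xi> - eval_at (s n x) \<xi>)) \<partial>M) \<longlonglongrightarrow> 0"
    proof (rule tendsto_sandwich[OF _ _ tendsto_const s(2)])
      show "\<forall>\<^sub>F n in sequentially. (\<integral>\<^sup>+ x. ennreal (norm (eval_at (f x) \<xi> - eval_at (s n x) \<xi>)) \<partial>M)
          \<le> (\<integral>\<^sup>+ x. ennreal (norm (f x - s n x)) \<partial>M)"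
        using eval_at_le by (intro always_eventually allI nn_integral_mono ennreal_leI)
          (simp flip: T.diff)
    qed simp
    show "(\<lambda>n. Bochner_Integration.simple_bochner_integral M (\<lambda>x. eval_at (s n x) \<xi>)) \<longlonglongrightarrow> eval_at v \<xi>"
      using T.tendsto[OF s(3)] by (simp add: simple_bochner_integral_linear[OF T.linear_axioms s(1)])
  qed
qed

text \<open>Separating \<open>v\<close> from \<open>{0}\<close> at distance \<open>norm v\<close>
  gives a norming functional, and the scalar integrand it produces is dominated by
  \<open>\<psi>\<close>.\<close>

lemma has_bochner_norm_le:
  fixes v :: "'b::real_normed_vector"
  assumes M: "complete_measure M" and f: "has_bochner M f v"
    and \<psi>: "integrable M \<psi>" and le: "AE x in M. norm (f x) \<le> \<psi> x"
  shows "norm v \<le> (\<integral>x. \<psi> x \<partial>M)"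
proof -
  obtain \<xi> :: "'b dual_ball" where "norm v \<le> eval_at v \<xi>"
    using dual_ball_separation[of "{0}" "norm v" v] by auto
  also have "eval_at v \<xi> = (\<integral>x. eval_at (f x) \<xi> \<partial>M)"
    using has_bochner_integral_eval_at[OF M f, of \<xi>] by (simp add: has_bochner_integral_integral_eq)
  also have "\<dots> \<le> (\<integral>x. \<psi> x \<partial>M)"
  proof (rule integral_mono_AE[OF _ \<psi>])
    show "integrable M (\<lambda>x. eval_at (f x) \<xi>)"
      using has_bochner_integral_eval_at[OF M f] by (rule integrable.intros)
    show "AE x in M. eval_at (f x) \<xi> \<le> \<psi> x"
      using le
    proof eventually_elim
      case (elim x)
      then show ?case using eval_at_le[of "f x" \<xi>] by linarith
    qed
  qed
  finally show ?thesis .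
qed

text \<open>Functionals in the dual ball separate points, and each of them takes the scalar integral
  as its value at both \<open>v\<close> and \<open>w\<close>.\<close>

lemma has_bochner_unique:
  fixes v w :: "'b::real_normed_vector"
  assumes M: "complete_measure M" and f: "has_bochner M f v" "has_bochner M f w"
  shows "v = w"
proof -
  obtain \<xi> :: "'b dual_ball" where "eval_at w \<xi> + norm (v - w) \<le> eval_at v \<xi>"
    using dual_ball_separation[of "{w}" "norm (v - w)" v] by auto
  moreover have "eval_at v \<xi> = eval_at w \<xi>"
    using f[THEN has_bochner_integral_eval_at[OF M]] by (rule has_bochner_integral_eq)
  ultimately show ?thesis by simp
qed

lemma has_bochner_bochner_integral:
  assumes "complete_measure M" "bochner_integrable M f"
  shows "has_bochner M f (bochner_integral M f)"
  unfolding bochner_integral_def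
  by (rule theI') (use assms has_bochner_unique in \<open>auto simp: bochner_integrable_def\<close>)

section \<open>Bochner integrability and restriction to subsets\<close>

text \<open>The integrals of \<open>s n\<close> and \<open>s m\<close> differ by at most the sum of
  the two approximation errors. They form a Cauchy sequence, and completeness of the space supplies
  the value of the integral.\<close>

lemma bochner_integrableI_sequence:
  fixes f :: "'s \<Rightarrow> 'b::banach"
  assumes M: "complete_measure M" and f: "strongly_measurable M f"
    and s: "\<And>n. Bochner_Integration.simple_bochner_integrable M (s n)"
    and lim: "(\<lambda>n. \<integral>\<^sup>+ x. ennreal (norm (f x - s n x)) \<partial>M) \<longlonglongrightarrow> 0" (is "?S \<longlonglongrightarrow> 0")
  shows "bochner_integrable M f"
proof -
  let ?i = "\<lambda>n. Bochner_Integration.simple_bochner_integral M (s n)"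
  have sf: "simple_function M (s n)" for n
    using s by (auto elim: Bochner_Integration.simple_bochner_integrable.cases)
  have bound: "ennreal (norm (?i n - ?i m)) \<le> ?S n + ?S m" for n m
  proof -
    have "ennreal (norm (?i n - ?i m))
        = norm (Bochner_Integration.simple_bochner_integral M (\<lambda>x. s n x - s m x))"
      using s by (subst simple_bochner_integral_diff) auto
    also have "\<dots> \<le> Bochner_Integration.simple_bochner_integral M (\<lambda>x. norm (s n x - s m x))"
      using simple_bochner_integrable_compose2[of "(-)" M "s n" "s m"] s
      by (auto intro!: simple_bochner_integral_norm_bound ennreal_leI)
    also have "\<dots> = (\<integral>\<^sup>+x. norm (s n x - s m x) \<partial>M)"
      using simple_bochner_integrable_compose2[of "\<lambda>x y. norm (x - y)" M "s n" "s m"] s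
      by (auto intro!: simple_bochner_integral_eq_nn_integral)
    also have "\<dots> \<le> (\<integral>\<^sup>+x. ennreal (norm (f x - s n x)) + ennreal (norm (f x - s m x)) \<partial>M)"
    proof (rule nn_integral_mono)
      fix x
      have "norm (s n x - s m x) \<le> norm (f x - s n x) + norm (f x - s m x)"
        by (metis norm_minus_commute norm_diff_triangle_le order_refl)
      then show "ennreal (norm (s n x - s m x)) \<le> ennreal (norm (f x - s n x)) + ennreal (norm (f x - s m x))"
        by (simp flip: ennreal_plus)
    qed
    also have "\<dots> = ?S n + ?S m"
      by (intro nn_integral_add measurable_compose[OF strongly_measurable_norm_diff_simple[OF M f sf]]
          measurable_ennreal)
    finally show ?thesis .
  qed
  have "Cauchy ?i"
  proof (rule metric_CauchyI)
    fix e :: real assume "0 < e"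
    then have e2: "0 < ennreal (e / 2)" by auto
    obtain N where N: "\<And>n. N \<le> n \<Longrightarrow> ?S n < e / 2"
      using order_tendstoD(2)[OF lim e2] by (auto simp: eventually_sequentially)
    show "\<exists>N. \<forall>m\<ge>N. \<forall>n\<ge>N. dist (?i m) (?i n) < e"
    proof (intro exI allI impI)
      fix m n assume m: "N \<le> m" and n: "N \<le> n"
      have "ennreal (norm (?i m - ?i n)) < ennreal (e / 2) + ennreal (e / 2)"
        using bound add_strict_mono[OF N[OF m] N[OF n]] by (rule le_less_trans)
      also have "\<dots> = e" using \<open>0 < e\<close> by (simp flip: ennreal_plus)
      finally show "dist (?i m) (?i n) < e"
        using \<open>0 < e\<close> by (simp add: dist_norm ennreal_less_iff)
    qed
  qed
  then obtain v where "?i \<longlonglongrightarrow> v" by (auto simp: Cauchy_convergent_iff convergent_def)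
  then show ?thesis
    unfolding bochner_integrable_def has_bochner_def using f s lim by blast
qed

text \<open>The same simple functions approximate on \<open>S\<close>, since restricting the domain
  only decreases the errors; the limit of their integrals over \<open>S\<close> is provided by the
  preceding criterion.\<close>

lemma bochner_integrable_restrict_space:
  fixes f :: "'s \<Rightarrow> 'b::banach"
  assumes M: "complete_measure M" and f: "bochner_integrable M f" and S: "S \<in> sets M"
  shows "bochner_integrable (restrict_space M S) f"
proof -
  obtain s where sm: "strongly_measurable M f"
    and s: "\<And>n. Bochner_Integration.simple_bochner_integrable M (s n)"
    and lim: "(\<lambda>n. \<integral>\<^sup>+ x. ennreal (norm (f x - s n x)) \<partial>M) \<longlonglongrightarrow> 0"
    using f by (auto simp: bochner_integrable_def has_bochner_def)
  have SM: "S \<inter> space M \<in> sets M" using S sets.sets_into_space by auto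
  show ?thesis
  proof (rule bochner_integrableI_sequence)
    show "complete_measure (restrict_space M S)" by (rule complete_measure_restrict_space[OF M S])
    show "strongly_measurable (restrict_space M S) f" by (rule strongly_measurable_restrict_space[OF sm S])
    have ind: "simple_function M (indicator S :: 's \<Rightarrow> real)" using S by (rule simple_function_indicator)
    show "Bochner_Integration.simple_bochner_integrable (restrict_space M S) (s n)" for n
      unfolding simple_bochner_integrable_restrict_space[OF SM]
    proof
      have sf: "simple_function M (s n)"
        using s by (auto elim: Bochner_Integration.simple_bochner_integrable.cases)
      then show "simple_function M (\<lambda>x. indicator S x *\<^sub>R s n x)"
        by (rule simple_function_compose2[OF ind, where h = "(*\<^sub>R)"])
      have "emeasure M {x \<in> space M. indicator S x *\<^sub>R s n x \<noteq> 0} \<le> emeasure M {x \<in> space M. s n x \<noteq> 0}"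
        using simple_functionD(2)[OF sf, of "- {0}"]
        by (intro emeasure_mono) (auto simp: vimage_def Int_def conj_commute)
      then show "emeasure M {x \<in> space M. indicator S x *\<^sub>R s n x \<noteq> 0} \<noteq> \<infinity>"
        using s[of n] by (auto simp: Bochner_Integration.simple_bochner_integrable.simps top_unique)
    qed
    show "(\<lambda>n. \<integral>\<^sup>+ x. ennreal (norm (f x - s n x)) \<partial>restrict_space M S) \<longlonglongrightarrow> 0"
    proof (rule tendsto_sandwich[OF _ _ tendsto_const lim])
      show "\<forall>\<^sub>F n in sequentially. (\<integral>\<^sup>+ x. ennreal (norm (f x - s n x)) \<partial>restrict_space M S)
          \<le> (\<integral>\<^sup>+ x. ennreal (norm (f x - s n x)) \<partial>M)"
        by (intro always_eventually allI)
          (auto simp: nn_integral_restrict_space[OF SM] intro!: nn_integral_mono split: split_indicator)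
    qed simp
  qed
qed

section \<open>Partitions with small oscillation\<close>

text \<open>
  Simple functions converging to \<open>f\<close> are uniformly Cauchy up to a set on which the integral of
  \<open>\<psi>\<close> is small; the level sets of one of them then have small oscillation.
\<close>

lemma strongly_measurable_partition:
  fixes f :: "'s \<Rightarrow> 'b::metric_space" and \<psi> :: "'s \<Rightarrow> real"
  assumes f: "strongly_measurable M f" and \<psi>: "integrable M \<psi>" and P: "AE x in M. P x"
    and \<delta>: "0 < \<delta>" and \<eta>: "0 < \<eta>"
  obtains K and E :: "'b \<Rightarrow> 's set"
  where "finite K" "\<And>k. E k \<in> sets M" "disjoint_family_on E K"
    "\<And>k. k \<in> K \<Longrightarrow> E k \<noteq> {}" "\<And>k x. x \<in> E k \<Longrightarrow> P x"
    "\<And>k x y. x \<in> E k \<Longrightarrow> y \<in> E k \<Longrightarrow> dist (f x) (f y) \<le> \<delta>"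
    "(\<integral>x. indicator (space M - (\<Union>k\<in>K. E k)) x * \<psi> x \<partial>M) < \<eta>"
proof -
  obtain s where s: "\<And>n. simple_function M (s n)" and lim: "AE x in M. (\<lambda>n. s n x) \<longlonglongrightarrow> f x"
    using f by (auto simp: strongly_measurable_def)
  obtain N where N: "N \<in> null_sets M" "\<And>x. x \<in> space M - N \<Longrightarrow> P x"
    "\<And>x. x \<in> space M - N \<Longrightarrow> (\<lambda>n. s n x) \<longlonglongrightarrow> f x"
    using AE_conjI[OF P lim] by (auto simp: eventually_ae_filter)
  \<comment> \<open>These sets are described by the simple functions alone, which makes them
    measurable.\<close>
  define F where "F = (\<lambda>n. {x \<in> space M. \<forall>i\<ge>n. \<forall>j\<ge>n. dist (s i x) (s j x) \<le> \<delta> / 2})"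
  have [measurable]: "(\<lambda>x. dist (s i x) (s j x)) \<in> borel_measurable M" for i j
    by (intro borel_measurable_simple_function simple_function_compose2[OF s s])
  have F [measurable]: "F n \<in> sets M" for n
    unfolding F_def by measurable
  have [measurable]: "\<psi> \<in> borel_measurable M" using \<psi> by auto
  \<comment> \<open>An argument in the style of Egorov: convergent sequences are Cauchy, so almost
    every point lies in \<open>F n\<close> for all large \<open>n\<close>, and dominated convergence
    makes the remainder small.\<close>
  have "(\<lambda>n. \<integral>x. indicator (space M - F n) x * \<psi> x \<partial>M) \<longlonglongrightarrow> (\<integral>x. 0 \<partial>M)"
  proof (rule integral_dominated_convergence)
    show "integrable M (\<lambda>x. \<bar>\<psi> x\<bar>)" using \<psi> by simp
    show "AE x in M. (\<lambda>n. indicator (space M - F n) x * \<psi> x) \<longlonglongrightarrow> 0"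
      using lim AE_space
    proof eventually_elim
      case (elim x)
      obtain n where n: "\<And>i j. i \<ge> n \<Longrightarrow> j \<ge> n \<Longrightarrow> dist (s i x) (s j x) < \<delta> / 2"
        using metric_CauchyD[OF LIMSEQ_imp_Cauchy[OF elim(1)], of "\<delta> / 2"] \<delta> by auto
      have "indicator (space M - F m) x * \<psi> x = 0" if "m \<ge> n" for m
        using n that elim(2) by (force simp: F_def indicator_def intro!: less_imp_le)
      then show ?case by (intro tendsto_eventually) (auto simp: eventually_sequentially)
    qed
    show "AE x in M. norm (indicator (space M - F n) x * \<psi> x) \<le> \<bar>\<psi> x\<bar>" for n
      by (auto simp: indicator_def)
  qed auto
  then obtain n where n: "(\<integral>x. indicator (space M - F n) x * \<psi> x \<partial>M) < \<eta>"
    using order_tendstoD(2)[of _ 0 sequentially \<eta>] \<eta> by (auto simp: eventually_sequentially)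
  \<comment> \<open>The pieces are indexed by the values of \<open>s n\<close>; for \<open>k\<close>
    outside \<open>K\<close> the piece is empty, so the claims without \<open>k \<in> K\<close> hold
    for every index.\<close>
  define E where "E = (\<lambda>k. {x \<in> F n - N. s n x = k})"
  define K where "K = s n ` (F n - N)"
  have UE: "(\<Union>k\<in>K. E k) = F n - N" by (auto simp: E_def K_def)
  \<comment> \<open>The Cauchy bound passes to the limit. Two points of one piece are then compared
    through the common value of \<open>s n\<close>, at a cost of \<open>\<delta> / 2\<close>
    each.\<close>
  have near: "dist (f x) (s n x) \<le> \<delta> / 2" if "x \<in> F n - N" for x
  proof (rule LIMSEQ_le_const2)
    show "(\<lambda>m. dist (s m x) (s n x)) \<longlonglongrightarrow> dist (f x) (s n x)"
      using that N(3)[of x] by (intro tendsto_intros) (auto simp: F_def)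
    show "\<exists>N. \<forall>m\<ge>N. dist (s m x) (s n x) \<le> \<delta> / 2"
      using that by (auto simp: F_def)
  qed
  show ?thesis
  proof
    have "finite (s n ` space M)" using s by (auto simp: simple_function_def)
    then show "finite K" by (rule rev_finite_subset) (auto simp: K_def F_def)
    show "E k \<in> sets M" for k
    proof -
      have "E k = (s n -` {k} \<inter> space M) \<inter> (F n - N)" by (auto simp: E_def F_def)
      then show ?thesis using simple_functionD(2)[OF s, of n "{k}"] N(1) F by auto
    qed
    show "disjoint_family_on E K" by (auto simp: disjoint_family_on_def E_def)
    show "E k \<noteq> {}" if "k \<in> K" for k using that by (auto simp: E_def K_def)
    show "P x" if "x \<in> E k" for k x using that N(2) by (auto simp: E_def F_def)
    show "dist (f x) (f y) \<le> \<delta>" if "x \<in> E k" "y \<in> E k" for k x y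
      using near[of x] near[of y] dist_triangle2[of "f x" "f y" k] that by (auto simp: E_def)
    have "(\<integral>x. indicator (space M - (\<Union>k\<in>K. E k)) x * \<psi> x \<partial>M)
        = (\<integral>x. indicator (space M - F n) x * \<psi> x \<partial>M)"
    proof (rule integral_cong_AE)
      show "AE x in M. indicator (space M - (\<Union>k\<in>K. E k)) x * \<psi> x = indicator (space M - F n) x * \<psi> x"
        using AE_not_in[OF N(1)] by eventually_elim (auto simp: UE indicator_def)
    qed (use N(1) in \<open>auto simp: UE\<close>)
    then show "(\<integral>x. indicator (space M - (\<Union>k\<in>K. E k)) x * \<psi> x \<partial>M) < \<eta>" using n by simp
  qed
qed

section \<open>Convex measures of noncompactness\<close>

lemma convex_mnc_nonneg: "convex_mnc \<mu> \<Longrightarrow> B \<in> bounded_sets \<Longrightarrow> 0 \<le> \<mu> B"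
  and convex_mnc_mono:
    "convex_mnc \<mu> \<Longrightarrow> A \<in> bounded_sets \<Longrightarrow> B \<in> bounded_sets \<Longrightarrow> B \<subseteq> A \<Longrightarrow> \<mu> B \<le> \<mu> A"
  and convex_mnc_hull: "convex_mnc \<mu> \<Longrightarrow> B \<in> bounded_sets \<Longrightarrow> \<mu> (convex hull B) = \<mu> B"
  and convex_mnc_combine:
    "convex_mnc \<mu> \<Longrightarrow> A \<in> bounded_sets \<Longrightarrow> B \<in> bounded_sets \<Longrightarrow> 0 \<le> l \<Longrightarrow> l \<le> 1 \<Longrightarrow>
      \<mu> ((*\<^sub>R) l ` A + (*\<^sub>R) (1 - l) ` B) \<le> l * \<mu> A + (1 - l) * \<mu> B"
  by (auto simp: convex_mnc_def mnc_axioms_def)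

lemma convex_mnc_zero: "convex_mnc \<mu> \<Longrightarrow> \<mu> {0} = 0"
  by (auto simp: convex_mnc_def mnc_axioms_def bounded_sets_def)

lemma bounded_sets_scaleR: "A \<in> bounded_sets \<Longrightarrow> (*\<^sub>R) c ` A \<in> bounded_sets"
  by (auto simp: bounded_sets_def bounded_scaling)

lemma bounded_sets_set_plus: "A \<in> bounded_sets \<Longrightarrow> B \<in> bounded_sets \<Longrightarrow> A + B \<in> bounded_sets"
proof -
  have "A + B = (\<Union>x\<in>A. \<Union>y\<in>B. {x + y})" by (auto simp: set_plus_def)
  then show "A \<in> bounded_sets \<Longrightarrow> B \<in> bounded_sets \<Longrightarrow> A + B \<in> bounded_sets"
    by (simp add: bounded_sets_def bounded_sums)
qed

lemma bounded_sets_subset: "B \<in> bounded_sets \<Longrightarrow> A \<subseteq> B \<Longrightarrow> A \<noteq> {} \<Longrightarrow> A \<in> bounded_sets"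
  by (auto simp: bounded_sets_def intro: bounded_subset)

lemma bounded_sets_convex_hull: "A \<in> bounded_sets \<Longrightarrow> convex hull A \<in> bounded_sets"
  by (auto simp: bounded_sets_def bounded_convex_hull)

text \<open>The dilate is the convex combination of \<open>A\<close> with the compact set
  \<open>{0}\<close>, whose measure is 0.\<close>

lemma convex_mnc_scaleR_le:
  assumes \<mu>: "convex_mnc \<mu>" and A: "A \<in> bounded_sets" and c: "0 \<le> c" "c \<le> 1"
  shows "\<mu> ((*\<^sub>R) c ` A) \<le> c * \<mu> A"
proof -
  have "(*\<^sub>R) c ` A + (*\<^sub>R) (1 - c) ` {0} = (*\<^sub>R) c ` A" by simp
  then show ?thesis
    using convex_mnc_combine[OF \<mu> A _ c, of "{0}"] convex_mnc_zero[OF \<mu>]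
    by (simp add: bounded_sets_def)
qed

text \<open>
  The proof rests on the inclusion
  \<open>B + \<epsilon>U \<subseteq> (1 - \<epsilon>)B + \<epsilon>(B + U)\<close> for the unit ball \<open>U\<close>, applied to the part of \<open>B\<close> close to \<open>A\<close>.
\<close>

lemma convex_mnc_le_perturb:
  fixes A B :: "'a::real_normed_vector set"
  assumes \<mu>: "convex_mnc \<mu>" and A: "A \<noteq> {}" "A \<subseteq> cball 0 r" and B: "B \<in> bounded_sets"
    and e: "0 \<le> e" "e \<le> 1" and near: "\<And>x. x \<in> A \<Longrightarrow> \<exists>b\<in>B. norm (x - b) \<le> e"
  shows "\<mu> A \<le> \<mu> B + e * \<mu> (cball 0 (r + 2))"
proof -
  \<comment> \<open>Discarding the points of \<open>B\<close> far from \<open>A\<close> makes the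
    constant in the bound depend on \<open>r\<close> only and not on the size of
    \<open>B\<close>.\<close>
  define B' where "B' = {b \<in> B. \<exists>x\<in>A. norm (x - b) \<le> e}"
  have A': "A \<in> bounded_sets" using A bounded_subset[OF bounded_cball] by (auto simp: bounded_sets_def)
  have B': "B' \<in> bounded_sets"
    using A(1) near by (intro bounded_sets_subset[OF B]) (auto simp: B'_def)
  obtain x0 where "x0 \<in> A" using A by blast
  then have r: "0 \<le> r" using A norm_ge_zero[of x0] by (force simp del: norm_ge_zero)
  have U: "cball (0::'a) 1 \<in> bounded_sets" by (auto simp: bounded_sets_def)
  have ball: "cball (0::'a) (r + 2) \<in> bounded_sets" using r by (auto simp: bounded_sets_def)
  have BU: "B' + cball 0 1 \<in> bounded_sets" by (rule bounded_sets_set_plus[OF B' U])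
  have "A \<subseteq> (*\<^sub>R) (1 - e) ` B' + (*\<^sub>R) (1 - (1 - e)) ` (B' + cball 0 1)"
  proof
    fix x assume x: "x \<in> A"
    then obtain b where b: "b \<in> B'" "norm (x - b) \<le> e" using near[OF x] by (auto simp: B'_def)
    \<comment> \<open>For \<open>e = 0\<close> the division yields \<open>u = 0\<close>, which is
      harmless because then \<open>x = b\<close>.\<close>
    define u where "u = (x - b) /\<^sub>R e"
    have eu: "e *\<^sub>R u = x - b" using b e by (cases "e = 0") (auto simp: u_def)
    have "norm u = norm (x - b) / e" using e by (simp add: u_def divide_inverse mult.commute)
    then have "norm u \<le> 1" using b e by (cases "e = 0") auto
    then have "b + u \<in> B' + cball 0 1" using b by auto
    moreover have "x = (1 - e) *\<^sub>R b + (1 - (1 - e)) *\<^sub>R (b + u)"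
      using eu by (simp add: algebra_simps)
    ultimately show "x \<in> (*\<^sub>R) (1 - e) ` B' + (*\<^sub>R) (1 - (1 - e)) ` (B' + cball 0 1)"
      using b by (metis imageI set_plus_intro)
  qed
  then have "\<mu> A \<le> \<mu> ((*\<^sub>R) (1 - e) ` B' + (*\<^sub>R) (1 - (1 - e)) ` (B' + cball 0 1))"
    by (intro convex_mnc_mono[OF \<mu>] bounded_sets_set_plus bounded_sets_scaleR A' B' BU)
  also have "\<dots> \<le> (1 - e) * \<mu> B' + (1 - (1 - e)) * \<mu> (B' + cball 0 1)"
    using e by (intro convex_mnc_combine[OF \<mu> B' BU]) auto
  also have "\<dots> \<le> 1 * \<mu> B + e * \<mu> (cball 0 (r + 2))"
  proof (intro add_mono mult_mono)
    show "\<mu> B' \<le> \<mu> B" by (rule convex_mnc_mono[OF \<mu> B B']) (auto simp: B'_def)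
    \<comment> \<open>The radius is \<open>r\<close> for \<open>A\<close>, plus at most 1 for the
      distance \<open>e\<close>, plus 1 for the unit ball.\<close>
    have "B' + cball 0 1 \<subseteq> cball 0 (r + 2)"
    proof
      fix z assume "z \<in> B' + cball 0 1"
      then obtain b u x where z: "z = b + u" "norm u \<le> 1" "x \<in> A" "norm (x - b) \<le> e"
        by (auto simp: set_plus_def B'_def)
      have "norm b \<le> norm x + norm (x - b)" by (metis norm_minus_commute norm_triangle_sub)
      moreover have "norm x \<le> r" using A z by auto
      ultimately show "z \<in> cball 0 (r + 2)"
        using norm_triangle_ineq[of b u] z e by simp
    qed
    then show "\<mu> (B' + cball 0 1) \<le> \<mu> (cball 0 (r + 2))" by (rule convex_mnc_mono[OF \<mu> ball BU])
  qed (use e convex_mnc_nonneg[OF \<mu>] B' BU in auto)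
  finally show ?thesis by simp
qed

section \<open>Jensen's inequality for Minkowski combinations\<close>

text \<open>The Minkowski combination of finitely many sets, encoded by choice functions; their
  values outside \<open>K\<close> do not enter the sum.\<close>

definition weighted_sum :: "'k set \<Rightarrow> ('k \<Rightarrow> real) \<Rightarrow> ('k \<Rightarrow> 'a set) \<Rightarrow> 'a::real_vector set" where
  "weighted_sum K w C = (\<lambda>c. \<Sum>k\<in>K. w k *\<^sub>R c k) ` Pi K C"

lemma convex_weighted_sum:
  assumes C: "\<And>k. k \<in> K \<Longrightarrow> convex (C k)"
  shows "convex (weighted_sum K w C)"
proof (rule convexI)
  fix x y and u v :: real
  assume "x \<in> weighted_sum K w C" "y \<in> weighted_sum K w C" and uv: "0 \<le> u" "0 \<le> v" "u + v = 1"
  then obtain c d where c: "c \<in> Pi K C" "x = (\<Sum>k\<in>K. w k *\<^sub>R c k)"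
    and d: "d \<in> Pi K C" "y = (\<Sum>k\<in>K. w k *\<^sub>R d k)"
    by (auto simp: weighted_sum_def)
  have "(\<lambda>k. u *\<^sub>R c k + v *\<^sub>R d k) \<in> Pi K C"
    using c d uv C by (auto intro!: convexD)
  moreover have "u *\<^sub>R x + v *\<^sub>R y = (\<Sum>k\<in>K. w k *\<^sub>R (u *\<^sub>R c k + v *\<^sub>R d k))"
    by (simp add: c d scaleR_sum_right sum.distrib scaleR_add_right mult.commute)
  ultimately show "u *\<^sub>R x + v *\<^sub>R y \<in> weighted_sum K w C"
    unfolding weighted_sum_def by (simp add: rev_image_eqI)
qed

lemma bounded_sets_weighted_sum:
  assumes C: "\<And>k. k \<in> K \<Longrightarrow> C k \<in> bounded_sets"
  shows "weighted_sum K w C \<in> bounded_sets"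
proof -
  have "\<exists>R. \<forall>x\<in>C k. norm x \<le> R" if "k \<in> K" for k
    using C[OF that] by (auto simp: bounded_sets_def bounded_iff)
  then obtain R where R: "\<And>k x. k \<in> K \<Longrightarrow> x \<in> C k \<Longrightarrow> norm x \<le> R k" by metis
  have "norm x \<le> (\<Sum>k\<in>K. \<bar>w k\<bar> * R k)" if "x \<in> weighted_sum K w C" for x
    using that R unfolding weighted_sum_def
    by (auto simp: Pi_iff intro!: sum_norm_le mult_left_mono)
  moreover have "Pi K C \<noteq> {}" using C by (auto simp: Pi_eq_empty bounded_sets_def)
  ultimately show ?thesis
    by (auto simp: bounded_sets_def weighted_sum_def bounded_iff)
qed

text \<open>Induction splits off one set and rescales the other weights by \<open>1 - w j\<close>.
  The weights may add up to less than 1, because the pieces of a partition with remainder do not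
  exhaust the space; the missing weight rests on \<open>{0}\<close>.\<close>

lemma convex_mnc_weighted_sum_le:
  assumes \<mu>: "convex_mnc \<mu>" and "finite K" "\<And>k. k \<in> K \<Longrightarrow> 0 \<le> w k" "(\<Sum>k\<in>K. w k) \<le> 1"
    "\<And>k. k \<in> K \<Longrightarrow> C k \<in> bounded_sets"
  shows "\<mu> (weighted_sum K w C) \<le> (\<Sum>k\<in>K. w k * \<mu> (C k))"
  using assms(2-)
proof (induction K arbitrary: w rule: finite_induct)
  case empty
  have "weighted_sum {} w C = {0}" by (auto simp: weighted_sum_def)
  then show ?case using convex_mnc_zero[OF \<mu>] by simp
next
  case (insert j K)
  define w' where "w' = (\<lambda>k. w k / (1 - w j))"
  have sum: "w j + (\<Sum>k\<in>K. w k) \<le> 1" using insert by simp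
  have nonneg: "0 \<le> (\<Sum>k\<in>K. w k)" using insert by (intro sum_nonneg) auto
  then have wj: "0 \<le> w j" "w j \<le> 1" using insert.prems(1)[of j] sum by auto
  \<comment> \<open>If \<open>w j = 1\<close>, the quotient is 0 by convention, in agreement with
    the fact that all other weights vanish.\<close>
  have w': "w k = (1 - w j) * w' k" if "k \<in> K" for k
  proof (cases "w j = 1")
    case True
    then have "(\<Sum>k\<in>K. w k) = 0" using sum nonneg by simp
    then show ?thesis
      using that insert.hyps insert.prems(1) True by (subst (asm) sum_nonneg_eq_0_iff) auto
  qed (simp add: w'_def)
  have w'sum: "(\<Sum>k\<in>K. w' k) \<le> 1"
    unfolding w'_def sum_divide_distrib[symmetric] using sum wj by (cases "w j = 1") (auto simp: divide_le_eq_1)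
  have w'pos: "0 \<le> w' k" if "k \<in> K" for k
    using insert.prems(1)[of k] that wj by (simp add: w'_def)
  have b: "C j \<in> bounded_sets" "weighted_sum K w' C \<in> bounded_sets"
    using insert.prems by (auto intro: bounded_sets_weighted_sum)
  have "weighted_sum (insert j K) w C \<subseteq> (*\<^sub>R) (w j) ` C j + (*\<^sub>R) (1 - w j) ` weighted_sum K w' C"
  proof
    fix x assume "x \<in> weighted_sum (insert j K) w C"
    then obtain c where c: "c \<in> Pi (insert j K) C" "x = (\<Sum>k\<in>insert j K. w k *\<^sub>R c k)"
      by (auto simp: weighted_sum_def)
    have "x = w j *\<^sub>R c j + (\<Sum>k\<in>K. w k *\<^sub>R c k)" using c insert.hyps by simp
    also have "(\<Sum>k\<in>K. w k *\<^sub>R c k) = (1 - w j) *\<^sub>R (\<Sum>k\<in>K. w' k *\<^sub>R c k)"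
      unfolding scaleR_sum_right by (rule sum.cong) (simp_all add: w')
    finally show "x \<in> (*\<^sub>R) (w j) ` C j + (*\<^sub>R) (1 - w j) ` weighted_sum K w' C"
      using c unfolding weighted_sum_def by auto
  qed
  then have "\<mu> (weighted_sum (insert j K) w C)
      \<le> \<mu> ((*\<^sub>R) (w j) ` C j + (*\<^sub>R) (1 - w j) ` weighted_sum K w' C)"
    by (intro convex_mnc_mono[OF \<mu>] bounded_sets_set_plus bounded_sets_scaleR b
        bounded_sets_weighted_sum insert.prems)
  also have "\<dots> \<le> w j * \<mu> (C j) + (1 - w j) * \<mu> (weighted_sum K w' C)"
    by (rule convex_mnc_combine[OF \<mu> b wj])
  also have "\<dots> \<le> w j * \<mu> (C j) + (1 - w j) * (\<Sum>k\<in>K. w' k * \<mu> (C k))"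
    using wj insert.prems w'pos w'sum by (intro add_left_mono mult_left_mono insert.IH) auto
  also have "\<dots> = (\<Sum>k\<in>insert j K. w k * \<mu> (C k))"
    using insert.hyps by (simp add: sum_distrib_left w' mult.assoc)
  finally show ?case .
qed

section \<open>The integral inequality\<close>

lemma exists_almost_minimal:
  fixes \<nu> :: "'s \<Rightarrow> real"
  assumes "E \<noteq> {}" "\<And>x. x \<in> E \<Longrightarrow> 0 \<le> \<nu> x" "0 < e"
  shows "\<exists>x\<in>E. \<forall>y\<in>E. \<nu> x \<le> \<nu> y + e"
proof -
  have bdd: "bdd_below (\<nu> ` E)" using assms(2) by (auto intro!: bdd_belowI2)
  obtain x where x: "x \<in> E" "\<nu> x < (INF y\<in>E. \<nu> y) + e"
    using cInf_lessD[of "\<nu> ` E" "(INF y\<in>E. \<nu> y) + e"] assms(1,3) by auto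
  then show ?thesis using cINF_lower[OF bdd] by (intro bexI[of _ x]) force+
qed

text \<open>
  A functional separating the mean value from the weighted sum would contradict the estimate of its
  integral by values of \<^const>\<open>J_map\<close>.
\<close>

lemma bochner_mean_near_weighted_sum:
  fixes G :: "(real \<Rightarrow> 'a::real_normed_vector) set" and E :: "'k \<Rightarrow> real set"
  assumes M: "complete_measure M" "finite_measure M"
    and \<tau>: "\<tau> = measure M (space M)" "0 < \<tau>" and e: "0 < e"
    and g: "g \<in> G" "has_bochner M g v"
    and \<psi>: "integrable M \<psi>" and dom: "AE s in M. \<forall>g\<in>G. norm (g s) \<le> \<psi> s"
    and E: "finite K" "\<And>k. E k \<in> sets M" "disjoint_family_on E K"
    and EP: "\<And>k s. s \<in> E k \<Longrightarrow> \<forall>g\<in>G. norm (g s) \<le> \<psi> s"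
    and osc: "\<And>k s s'. s \<in> E k \<Longrightarrow> s' \<in> E k \<Longrightarrow> dist (J_map G s) (J_map G s') \<le> e / 4"
    and rest: "(\<integral>s. indicator (space M - (\<Union>k\<in>K. E k)) s * \<psi> s \<partial>M) < e * \<tau> / 4"
    and p: "\<And>k. k \<in> K \<Longrightarrow> p k \<in> E k"
  defines "B \<equiv> weighted_sum K (\<lambda>k. measure M (E k) / \<tau>) (\<lambda>k. convex hull ((\<lambda>g. g (p k)) ` G))"
  shows "\<exists>b\<in>B. norm (v /\<^sub>R \<tau> - b) \<le> e"
proof (rule ccontr)
  interpret finite_measure M by (rule M(2))
  assume "\<not> (\<exists>b\<in>B. norm (v /\<^sub>R \<tau> - b) \<le> e)"
  then have far: "e \<le> norm (v /\<^sub>R \<tau> - b)" if "b \<in> B" for b using that by force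
  have "convex B" unfolding B_def by (rule convex_weighted_sum) simp
  moreover have "B \<noteq> {}" using g(1) by (auto simp: B_def weighted_sum_def Pi_eq_empty)
  ultimately obtain \<xi> :: "'a dual_ball" where \<xi>: "\<And>b. b \<in> B \<Longrightarrow> eval_at b \<xi> + e \<le> eval_at (v /\<^sub>R \<tau>) \<xi>"
    using dual_ball_separation[OF _ _ far] by blast
  have bdd: "bounded ((\<lambda>g. g s) ` G)" if "s \<in> E k" for s k
    using EP[OF that] by (auto simp: bounded_iff)
  have bdda: "bdd_above ((\<lambda>g. eval_at (g s) \<xi>) ` G)" if "s \<in> E k" for s k
  proof (rule bdd_aboveI2)
    fix h assume "h \<in> G"
    then show "eval_at (h s) \<xi> \<le> \<psi> s" using EP[OF that] eval_at_le[of "h s" \<xi>] by fastforce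
  qed
  have J: "apply_bcontfun (J_map G s) \<xi> = (SUP g\<in>G. eval_at (g s) \<xi>)" if "s \<in> E k" for s k
    using g(1) bdd[OF that] by (intro apply_J_map) auto
  \<comment> \<open>An element of \<open>G\<close> that almost attains the supremum at
    \<open>p k\<close> in the direction \<open>\<xi>\<close>; these elements assemble the point
    \<open>b\<close> of \<open>B\<close> that contradicts the separation.\<close>
  have "\<exists>h\<in>G. apply_bcontfun (J_map G (p k)) \<xi> - e / 4 < eval_at (h (p k)) \<xi>" if "k \<in> K" for k
  proof -
    have "(SUP g\<in>G. eval_at (g (p k)) \<xi>) - e / 4 < (SUP g\<in>G. eval_at (g (p k)) \<xi>)" using e by simp
    then show ?thesis
      using less_cSUP_iff[OF _ bdda[OF p[OF that]]] g(1) unfolding J[OF p[OF that]] by blast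
  qed
  then obtain h where h: "\<And>k. k \<in> K \<Longrightarrow> h k \<in> G"
    "\<And>k. k \<in> K \<Longrightarrow> apply_bcontfun (J_map G (p k)) \<xi> - e / 4 < eval_at (h k (p k)) \<xi>"
    by metis
  define c where "c = (\<lambda>k. h k (p k))"
  define b where "b = (\<Sum>k\<in>K. (measure M (E k) / \<tau>) *\<^sub>R c k)"
  have bB: "b \<in> B"
    unfolding B_def weighted_sum_def b_def c_def using h(1) by (auto intro!: imageI hull_inc)
  \<comment> \<open>One \<open>e / 4\<close> pays for the oscillation of \<open>J_map G\<close>
    between \<open>s\<close> and \<open>p k\<close>, the other for the almost attained
    supremum.\<close>
  have on_E: "eval_at (g s) \<xi> \<le> eval_at (c k) \<xi> + e / 2" if "k \<in> K" "s \<in> E k" for k s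
  proof -
    have "eval_at (g s) \<xi> \<le> apply_bcontfun (J_map G s) \<xi>"
      unfolding J[OF that(2)] by (rule cSUP_upper[OF g(1) bdda[OF that(2)]])
    moreover have "dist (apply_bcontfun (J_map G s) \<xi>) (apply_bcontfun (J_map G (p k)) \<xi>) \<le> e / 4"
      using osc[OF that(2) p[OF that(1)]] by (rule order_trans[OF dist_bounded])
    ultimately show ?thesis
      using h(2)[OF that(1)] unfolding c_def dist_real_def by linarith
  qed
  let ?R = "space M - (\<Union>k\<in>K. E k)"
  \<comment> \<open>The majorant is constant on each piece and equals \<open>\<psi>\<close> on the
    remainder.\<close>
  let ?u = "\<lambda>s. (\<Sum>k\<in>K. (eval_at (c k) \<xi> + e / 2) * indicator (E k) s) + indicator ?R s * \<psi> s"
  have R: "?R \<in> sets M" using E by auto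
  have intR: "integrable M (\<lambda>s. indicator ?R s * \<psi> s)"
    using integrable_mult_indicator[OF R \<psi>] by simp
  have intE: "integrable M (\<lambda>s. (eval_at (c k) \<xi> + e / 2) * indicator (E k) s)" for k
    using E(2) by (intro integrable_mult_right) (auto simp: less_top[symmetric])
  have "E ` K \<subseteq> sets M" using E(2) by blast
  then have measE: "(\<Sum>k\<in>K. measure M (E k)) \<le> \<tau>"
    unfolding \<tau>(1) using finite_measure_finite_Union[OF E(1) _ E(3)] by (metis bounded_measure)
  have "eval_at v \<xi> = (\<integral>s. eval_at (g s) \<xi> \<partial>M)"
    using has_bochner_integral_eval_at[OF M(1) g(2), of \<xi>] by (simp add: has_bochner_integral_integral_eq)
  also have "\<dots> \<le> (\<integral>s. ?u s \<partial>M)"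
  proof (rule integral_mono_AE)
    show "integrable M (\<lambda>s. eval_at (g s) \<xi>)"
      using has_bochner_integral_eval_at[OF M(1) g(2)] by (rule integrable.intros)
    show "integrable M ?u"
      by (intro Bochner_Integration.integrable_add Bochner_Integration.integrable_sum intE intR)
    show "AE s in M. eval_at (g s) \<xi> \<le> ?u s"
      using dom AE_space
    proof eventually_elim
      case (elim s)
      show ?case
      proof (cases "s \<in> ?R")
        case True
        then have "(\<Sum>k\<in>K. (eval_at (c k) \<xi> + e / 2) * indicator (E k) s) = 0"
          by (intro sum.neutral) simp
        moreover have "indicator ?R s * \<psi> s = \<psi> s" using True by (simp only: indicator_simps mult_1)
        moreover have "eval_at (g s) \<xi> \<le> \<psi> s"
          using elim(1) g(1) eval_at_le[of "g s" \<xi>] by fastforce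
        ultimately show ?thesis by linarith
      next
        case False
        then obtain k where k: "k \<in> K" "s \<in> E k" using elim(2) by blast
        have "(\<Sum>k\<in>K. (eval_at (c k) \<xi> + e / 2) * indicator (E k) s) = eval_at (c k) \<xi> + e / 2"
          by (rule sum_indicator_disjoint_family[OF E(3) k(2) E(1) k(1)])
        moreover have "indicator ?R s * \<psi> s = 0" using k by (subst indicator_simps(2)) auto
        ultimately show ?thesis using on_E[OF k] by linarith
      qed
    qed
  qed
  also have "\<dots> = (\<Sum>k\<in>K. (eval_at (c k) \<xi> + e / 2) * measure M (E k)) + (\<integral>s. indicator ?R s * \<psi> s \<partial>M)"
    using intE intR by (simp add: sets.Int_space_eq2[OF E(2)])
  also have "(\<Sum>k\<in>K. (eval_at (c k) \<xi> + e / 2) * measure M (E k))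
      = \<tau> * eval_at b \<xi> + e / 2 * (\<Sum>k\<in>K. measure M (E k))"
    using \<tau>(2) by (simp add: b_def eval_at_sum eval_at_scaleR sum_distrib_left distrib_left
        sum.distrib mult.commute[of _ "measure M _"] mult.commute[of e])
  also have "e / 2 * (\<Sum>k\<in>K. measure M (E k)) \<le> e / 2 * \<tau>"
    using measE e by (intro mult_left_mono) auto
  \<comment> \<open>The pieces contribute an error of \<open>e * \<tau> / 2\<close> and the
    remainder less than \<open>e * \<tau> / 4\<close>, in total less than the gap
    \<open>e * \<tau>\<close> forced by \<open>\<xi>\<close>.\<close>
  finally have "eval_at v \<xi> < \<tau> * eval_at b \<xi> + e * \<tau> * (3 / 4)"
    using rest by simp
  also have "\<dots> < \<tau> * (eval_at b \<xi> + e)"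
    using e \<tau>(2) by (simp add: algebra_simps)
  also have "\<dots> \<le> \<tau> * eval_at (v /\<^sub>R \<tau>) \<xi>"
    using \<xi>[OF bB] \<tau>(2) by (intro mult_left_mono) auto
  also have "\<dots> = eval_at v \<xi>"
    using \<tau>(2) by (simp add: eval_at_scaleR)
  finally show False by simp
qed

section \<open>The inequality on a finite complete measure space\<close>

text \<open>The set of integrals is the set \<open>S\<close> of mean values dilated by
  \<open>\<tau>\<close>. The two alternatives of the theorem are both reduced to
  \<open>scale\<close>; the rest is an estimate for \<open>S\<close> with an error that tends to
  0.\<close>

lemma convex_mnc_bochner_integral_le:
  fixes \<mu> :: "'a::real_normed_vector set \<Rightarrow> real" and G :: "(real \<Rightarrow> 'a) set"
  assumes M: "complete_measure M" "finite_measure M"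
    and \<tau>: "\<tau> = measure M (space M)" "0 < \<tau>"
    and \<mu>: "convex_mnc \<mu>" and scale: "\<And>A. A \<in> bounded_sets \<Longrightarrow> \<mu> ((*\<^sub>R) \<tau> ` A) \<le> \<tau> * \<mu> A"
    and G: "G \<noteq> {}" "G \<subseteq> L1 M"
    and \<psi>: "integrable M \<psi>" and dom: "AE s in M. \<forall>g\<in>G. norm (g s) \<le> \<psi> s"
    and J: "strongly_measurable M (J_map G)"
  shows "ennreal (\<mu> (bochner_integral M ` G)) \<le> (\<integral>\<^sup>+ s. ennreal (\<mu> ((\<lambda>g. g s) ` G)) \<partial>M)"
proof -
  interpret finite_measure M by (rule M(2))
  define I :: "(real \<Rightarrow> 'a) \<Rightarrow> 'a" where "I = bochner_integral M"
  define S where "S = (\<lambda>g. I g /\<^sub>R \<tau>) ` G"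
  define V where "V = (\<lambda>s. (\<lambda>g. g s) ` G)"
  define r where "r = (\<integral>s. \<psi> s \<partial>M) / \<tau>"
  \<comment> \<open>The constant of the perturbation bound; as all mean values lie in
    \<open>cball 0 r\<close>, it is the same for every partition.\<close>
  define L where "L = \<mu> (cball 0 (r + 2))"
  have I: "has_bochner M g (I g)" if "g \<in> G" for g
    using G(2) that unfolding I_def L1_def by (auto intro: has_bochner_bochner_integral[OF M(1)])
  have "norm (I g) \<le> (\<integral>s. \<psi> s \<partial>M)" if "g \<in> G" for g
    using dom that by (intro has_bochner_norm_le[OF M(1) I[OF that] \<psi>]) auto
  then have S: "S \<subseteq> cball 0 r" "S \<noteq> {}"
    using G(1) \<tau>(2) by (auto simp: S_def r_def divide_simps)
  then have Sb: "S \<in> bounded_sets" by (auto simp: bounded_sets_def intro: bounded_subset[OF bounded_cball])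
  have "0 \<le> r" using S by (metis cball_eq_empty not_le subset_empty)
  then have L: "0 \<le> L" unfolding L_def by (intro convex_mnc_nonneg[OF \<mu>]) (auto simp: bounded_sets_def)
  have T: "I ` G = (*\<^sub>R) \<tau> ` S" using \<tau>(2) by (auto simp: S_def image_image)
  \<comment> \<open>In the error term, \<open>e * \<tau>\<close> comes from the almost minimal
    choice of the points \<open>p k\<close> and \<open>e * \<tau> * L\<close> from the perturbation
    bound.\<close>
  have main: "ennreal (\<mu> (I ` G)) \<le> (\<integral>\<^sup>+ s. ennreal (\<mu> (V s)) \<partial>M) + ennreal (e * (\<tau> * (1 + L)))"
    if e: "0 < e" "e \<le> 1" for e
  proof -
    obtain K and E :: "('a dual_ball \<Rightarrow>\<^sub>C real) \<Rightarrow> real set" where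
      E: "finite K" "\<And>k. E k \<in> sets M" "disjoint_family_on E K" "\<And>k. k \<in> K \<Longrightarrow> E k \<noteq> {}"
      and EP: "\<And>k s. s \<in> E k \<Longrightarrow> \<forall>g\<in>G. norm (g s) \<le> \<psi> s"
      and osc: "\<And>k s s'. s \<in> E k \<Longrightarrow> s' \<in> E k \<Longrightarrow> dist (J_map G s) (J_map G s') \<le> e / 4"
      and rest: "(\<integral>s. indicator (space M - (\<Union>k\<in>K. E k)) s * \<psi> s \<partial>M) < e * \<tau> / 4"
      using strongly_measurable_partition[OF J \<psi> dom, of "e / 4" "e * \<tau> / 4"] e \<tau>(2)
      by (auto simp: zero_less_mult_iff)
    have V: "V s \<in> bounded_sets" if "s \<in> E k" for s k
      using EP[OF that] G(1) by (auto simp: V_def bounded_sets_def bounded_iff)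
    have "\<exists>x\<in>E k. \<forall>y\<in>E k. \<mu> (V x) \<le> \<mu> (V y) + e" if "k \<in> K" for k
      using E(4)[OF that] convex_mnc_nonneg[OF \<mu> V] e(1) by (rule exists_almost_minimal)
    then obtain p where p: "\<And>k. k \<in> K \<Longrightarrow> p k \<in> E k"
      and pmin: "\<And>k s. k \<in> K \<Longrightarrow> s \<in> E k \<Longrightarrow> \<mu> (V (p k)) \<le> \<mu> (V s) + e"
      by metis
    have Vp: "V (p k) \<in> bounded_sets" if "k \<in> K" for k using V p that by blast
    have "E ` K \<subseteq> sets M" using E(2) by blast
    then have measE: "(\<Sum>k\<in>K. measure M (E k)) \<le> \<tau>"
      unfolding \<tau>(1) using finite_measure_finite_Union[OF E(1) _ E(3)] by (metis bounded_measure)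
    define w where "w = (\<lambda>k. measure M (E k) / \<tau>)"
    define C where "C = (\<lambda>k. convex hull (V (p k)))"
    \<comment> \<open>Subtracting \<open>e\<close> brings the value at \<open>p k\<close> below
      \<open>\<mu> (V s)\<close> on the whole piece; truncation at 0 makes it a coefficient of a
      nonnegative simple function.\<close>
    define m where "m = (\<lambda>k. max 0 (\<mu> (V (p k)) - e))"
    have C: "C k \<in> bounded_sets" if "k \<in> K" for k
      unfolding C_def by (rule bounded_sets_convex_hull[OF Vp[OF that]])
    have B: "weighted_sum K w C \<in> bounded_sets"
      using C by (rule bounded_sets_weighted_sum)
    have "\<exists>b\<in>weighted_sum K w C. norm (x - b) \<le> e" if "x \<in> S" for x
    proof -
      obtain g where g: "g \<in> G" "x = I g /\<^sub>R \<tau>" using \<open>x \<in> S\<close> by (auto simp: S_def)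
      then show ?thesis
        using bochner_mean_near_weighted_sum[OF M \<tau> e(1) g(1) I[OF g(1)] \<psi> dom E(1-3) EP osc rest p]
        by (simp add: w_def C_def V_def)
    qed
    then have "\<mu> S \<le> \<mu> (weighted_sum K w C) + e * L"
      unfolding L_def using S B e by (intro convex_mnc_le_perturb[OF \<mu>]) auto
    also have "\<mu> (weighted_sum K w C) \<le> (\<Sum>k\<in>K. w k * \<mu> (C k))"
      using \<tau>(2) E(1) C measE
      by (intro convex_mnc_weighted_sum_le[OF \<mu>]) (auto simp: w_def sum_divide_distrib[symmetric])
    also have "(\<Sum>k\<in>K. w k * \<mu> (C k)) = (\<Sum>k\<in>K. w k * \<mu> (V (p k)))"
      unfolding C_def by (intro sum.cong refl) (simp add: convex_mnc_hull[OF \<mu> Vp])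
    finally have "\<tau> * \<mu> S \<le> \<tau> * ((\<Sum>k\<in>K. w k * \<mu> (V (p k))) + e * L)"
      using \<tau>(2) by simp
    then have "\<mu> (I ` G) \<le> \<tau> * ((\<Sum>k\<in>K. w k * \<mu> (V (p k))) + e * L)"
      using scale[OF Sb] by (simp add: T)
    also have "\<dots> = (\<Sum>k\<in>K. measure M (E k) * \<mu> (V (p k))) + e * (\<tau> * L)"
      using \<tau>(2) by (simp add: w_def distrib_left sum_distrib_left)
    also have "(\<Sum>k\<in>K. measure M (E k) * \<mu> (V (p k))) \<le> (\<Sum>k\<in>K. measure M (E k) * (m k + e))"
      by (intro sum_mono mult_left_mono) (auto simp: m_def)
    also have "\<dots> = (\<Sum>k\<in>K. measure M (E k) * m k) + e * (\<Sum>k\<in>K. measure M (E k))"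
      by (simp add: distrib_left sum.distrib sum_distrib_left mult.commute[of e])
    also have "e * (\<Sum>k\<in>K. measure M (E k)) \<le> e * \<tau>"
      using measE e by (intro mult_left_mono) auto
    finally have "\<mu> (I ` G) \<le> (\<Sum>k\<in>K. measure M (E k) * m k) + e * (\<tau> * (1 + L))"
      by (simp add: algebra_simps)
    then have "ennreal (\<mu> (I ` G)) \<le> ennreal ((\<Sum>k\<in>K. measure M (E k) * m k) + e * (\<tau> * (1 + L)))"
      by (rule ennreal_leI)
    also have "\<dots> = ennreal (\<Sum>k\<in>K. measure M (E k) * m k) + ennreal (e * (\<tau> * (1 + L)))"
      using e \<tau>(2) L by (intro ennreal_plus) (auto simp: m_def intro!: sum_nonneg)
    also have "ennreal (\<Sum>k\<in>K. measure M (E k) * m k) = (\<Sum>k\<in>K. ennreal (m k) * emeasure M (E k))"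
      by (subst sum_ennreal[symmetric])
        (auto simp: m_def emeasure_eq_measure ennreal_mult[symmetric] mult.commute intro!: sum.cong)
    also have "\<dots> = (\<integral>\<^sup>+ s. (\<Sum>k\<in>K. ennreal (m k) * indicator (E k) s) \<partial>M)"
      using E(2) by (subst nn_integral_sum) (auto simp: nn_integral_cmult_indicator)
    \<comment> \<open>The left side is the integral of a simple minorant, and monotonicity of the
      nonnegative integral holds for arbitrary integrands.\<close>
    also have "\<dots> \<le> (\<integral>\<^sup>+ s. ennreal (\<mu> (V s)) \<partial>M)"
    proof (rule nn_integral_mono)
      fix s
      show "(\<Sum>k\<in>K. ennreal (m k) * indicator (E k) s) \<le> ennreal (\<mu> (V s))"
      proof (cases "\<exists>k\<in>K. s \<in> E k")
        case True
        then obtain k where k: "k \<in> K" "s \<in> E k" by blast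
        have "(\<Sum>k\<in>K. ennreal (m k) * indicator (E k) s) = ennreal (m k)"
          by (rule sum_indicator_disjoint_family[OF E(3) k(2) E(1) k(1)])
        moreover have "m k \<le> \<mu> (V s)"
          using pmin[OF k] convex_mnc_nonneg[OF \<mu> V[OF k(2)]] by (simp add: m_def)
        ultimately show ?thesis by (simp add: ennreal_leI)
      next
        \<comment> \<open>Off the pieces \<open>V s\<close> may be unbounded and its measure
          unspecified; the minorant vanishes there.\<close>
        case False
        then have "(\<Sum>k\<in>K. ennreal (m k) * indicator (E k) s) = 0" by (intro sum.neutral) auto
        then show ?thesis by simp
      qed
    qed
    finally show ?thesis by (simp add: add_right_mono)
  qed
  have pos: "0 < \<tau> * (1 + L)" using \<tau>(2) L by simp
  have "ennreal (\<mu> (I ` G)) \<le> (\<integral>\<^sup>+ s. ennreal (\<mu> (V s)) \<partial>M)"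
  proof (rule ennreal_le_epsilon)
    fix \<epsilon> :: real assume \<epsilon>: "0 < \<epsilon>"
    \<comment> \<open>The cap at 1 is required by the perturbation bound; the quotient makes the
      error at most \<open>\<epsilon>\<close>.\<close>
    define e where "e = min 1 (\<epsilon> / (\<tau> * (1 + L)))"
    have "0 < e" "e \<le> 1" using \<epsilon> pos by (auto simp: e_def)
    have "e * (\<tau> * (1 + L)) \<le> \<epsilon>"
      using pos by (simp add: e_def pos_le_divide_eq[symmetric] del: pos_le_divide_eq)
    then have "ennreal (e * (\<tau> * (1 + L))) \<le> ennreal \<epsilon>" by (rule ennreal_leI)
    then show "ennreal (\<mu> (I ` G)) \<le> (\<integral>\<^sup>+ s. ennreal (\<mu> (V s)) \<partial>M) + ennreal \<epsilon>"
      using main[OF \<open>0 < e\<close> \<open>e \<le> 1\<close>] by (meson add_left_mono order_trans)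
  qed
  then show ?thesis by (simp add: I_def V_def)
qed

section \<open>Passage from the interval of length \<open>a\<close> to the one of length
  \<open>t\<close>\<close>

theorem corollary4p9:
  fixes \<mu> :: "'a::banach set \<Rightarrow> real"
    and G :: "(real \<Rightarrow> 'a) set"
    and \<psi> :: "real \<Rightarrow> real"
    and a t :: real
  assumes infinite_dim: "\<not> (\<exists>B::'a set. finite B \<and> span B = UNIV)"
    and mu: "convex_mnc \<mu>"
    and a: "0 < a"
    and G: "G \<noteq> {}" "G \<subseteq> L1 (lebesgue_on {0..a})" "L1_bounded (lebesgue_on {0..a}) G"
    and psi: "integrable (lebesgue_on {0..a}) \<psi>" "\<forall>s\<in>{0..a}. 0 \<le> \<psi> s"
    and dom: "AE s in lebesgue_on {0..a}. \<forall>g\<in>G. norm (g s) \<le> \<psi> s"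
    and J: "strongly_measurable (lebesgue_on {0..a}) (J_map G)"
    and t: "0 < t" "t \<le> a"
    and cond: "t \<le> min 1 a \<or> sublinear_mnc \<mu>"
  shows "ennreal (\<mu> (bochner_integral (lebesgue_on {0..t}) ` G))
           \<le> (\<integral>\<^sup>+ s. ennreal (\<mu> ((\<lambda>g. g s) ` G)) \<partial>lebesgue_on {0..t})"
proof -
  let ?A = "lebesgue_on {0..a}" and ?M = "lebesgue_on {0..t}"
  have sub: "{0..t} \<in> sets ?A" using t by (auto simp: sets_restrict_space_iff)
  have sub': "{0..t} \<inter> space ?A \<in> sets ?A" using sub by (simp only: sets.Int_space_eq2)
  \<comment> \<open>Viewing the smaller interval as a restriction of the larger one lets all
    hypotheses be inherited from there.\<close>
  have res: "?M = restrict_space ?A {0..t}"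
    using t by (subst restrict_restrict_space) (auto simp: Int_absorb1)
  have compl: "complete_measure ?A"
    by (intro complete_measure_restrict_space completion.complete_measure_axioms) simp
  have m: "measure ?M (space ?M) = t" using t by (simp add: measure_restrict_space)
  show ?thesis
  proof (rule convex_mnc_bochner_integral_le[OF _ _ m[symmetric] t(1) mu _ G(1)])
    show "complete_measure ?M" unfolding res by (rule complete_measure_restrict_space[OF compl sub])
    show "finite_measure ?M" by (rule finite_measure_lebesgue_on) simp
    show "\<mu> ((*\<^sub>R) t ` A) \<le> t * \<mu> A" if "A \<in> bounded_sets" for A
      using cond
    proof
      \<comment> \<open>For \<open>t \<le> 1\<close> the dilation is a convex combination with
        \<open>{0}\<close>; in the other case positive homogeneity covers every
        \<open>t\<close>.\<close>
      assume "t \<le> min 1 a"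
      then show ?thesis using t by (intro convex_mnc_scaleR_le[OF mu that]) auto
    next
      assume "sublinear_mnc \<mu>"
      then show ?thesis using t that by (simp add: sublinear_mnc_def)
    qed
    show "G \<subseteq> L1 ?M"
      using G(2) bochner_integrable_restrict_space[OF compl _ sub] by (auto simp: L1_def res)
    show "integrable ?M \<psi>"
      unfolding res integrable_restrict_space[OF sub'] by (rule integrable_mult_indicator[OF sub psi(1)])
    show "AE s in ?M. \<forall>g\<in>G. norm (g s) \<le> \<psi> s"
      unfolding res AE_restrict_space_iff[OF sub'] using dom by auto
    show "strongly_measurable ?M (J_map G)"
      unfolding res by (rule strongly_measurable_restrict_space[OF J sub])
  qed
qed

end
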